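(* For any $q$-matroid $M=(E_1\oplus E_2,r)$, the following are equivalent: (i) $M=(M|(E_1\oplus\mathbf{0}))\,\square\,(M/(E_1\oplus\mathbf{0}))$, where $M|(E_1\oplus\mathbf{0})$ is regarded as a $q$-matroid on $E_1$ and $M/(E_1\oplus\mathbf{0})$ as a $q$-matroid on $E_2\cong(E_1\oplus E_2)/(E_1\oplus\mathbf{0})$; (ii) $E_1\oplus\mathbf{0}$ is a free separator of $M$.
   Context: For a finite-dimensional $\mathbb{F}_q$-space $E$, $\mathcal{L}(E)$ is its subspace lattice and $\mathbf{0}$ the zero space. A $q$-matroid $M=(E,r)$ is given by $r:\mathcal{L}(E)\to\mathbb{Z}$ with (R1) $0\le r(A)\le\dim(A)$; (R2) $A\le B\Rightarrow r(A)\le r(B)$; (R3) $r(A+B)+r(A\cap B)\le r(A)+r(B)$. A subspace $A$ is independent if $r(A)=\dim A$, dependent otherwise; a circuit is an inclusion-minimal dependent space; a space is cyclic if it is a (possibly empty) sum of circuits; $A$ is a flat if it is inclusion-maximal among the subspaces of rank $r(A)$; a cyclic flat is a space that is both cyclic and a flat. A subspace $A\le E$ is a free separator of $M$ if every cyclic flat $Z$ of $M$ satisfies $Z\le A$ or $A\le Z$. The restriction $M|A$ is $(A,r|_{\mathcal{L}(A)})$; the contraction $M/A$ is the $q$-matroid on $E/A$ with rank function $X/A\mapsto r(X)-r(A)$ for $A\le X\le E$. Free product: for $q$-matroids $M_i=(E_i,r_i)$, $i=1,2$, with projections $\pi_i:E_1\oplus E_2\to E_i$ and embeddings $\iota_i:E_i\to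 E_1\oplus E_2$, put $\lambda_1(A)=r_1(E_1)-r_1(A)$ and $\nu_2(B)=\dim(B)-r_2(B)$. $M_1\square M_2$ is the $q$-matroid on $E_1\oplus E_2$ whose independent spaces are exactly the $I\le E_1\oplus E_2$ with $\pi_1(I\cap\iota_1(E_1))$ independent in $M_1$ and $\lambda_1(\pi_1(I\cap\iota_1(E_1)))\ge\nu_2(\pi_2(I))$. *)

theory Defs
  imports "HOL-Analysis.Product_Vector" "HOL-Library.FuncSet"
begin

section \<open>q-Matroids\<close>

text \<open>The ambient space of a \<open>q\<close>-matroid is a whole type, made a vector space by the scalar
  multiplication \<open>s\<close> (over a finite field, in the applications).  A \<open>q\<close>-matroid is represented by its
  rank function.  The domain of this function is the lattice of subspaces, so the function is required
  to be \<^const>\<open>extensional\<close> there; equality of \<open>q\<close>-matroids is thus equality of functions.\<close>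

definition subspaces :: "('f::field \<Rightarrow> 'v::ab_group_add \<Rightarrow> 'v) \<Rightarrow> 'v set set" where
  "subspaces s = {A. module.subspace s A}"

definition q_matroid ::
    "('f::field \<Rightarrow> 'v::ab_group_add \<Rightarrow> 'v) \<Rightarrow> ('v set \<Rightarrow> int) \<Rightarrow> bool" where
  "q_matroid s r \<longleftrightarrow>
     r \<in> extensional (subspaces s) \<and>
     (\<forall>A\<in>subspaces s. 0 \<le> r A \<and> r A \<le> int (vector_space.dim s A)) \<and>
     (\<forall>A\<in>subspaces s. \<forall>B\<in>subspaces s. A \<subseteq> B \<longrightarrow> r A \<le> r B) \<and>
     (\<forall>A\<in>subspaces s. \<forall>B\<in>subspaces s.
        r {a + b | a b. a \<in> A \<and> b \<in> B} + r (A \<inter> B) \<le> r A + r B)"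

definition indep_space ::
    "('f::field \<Rightarrow> 'v::ab_group_add \<Rightarrow> 'v) \<Rightarrow> ('v set \<Rightarrow> int) \<Rightarrow> 'v set \<Rightarrow> bool" where
  "indep_space s r A \<longleftrightarrow> A \<in> subspaces s \<and> r A = int (vector_space.dim s A)"

definition dep_space ::
    "('f::field \<Rightarrow> 'v::ab_group_add \<Rightarrow> 'v) \<Rightarrow> ('v set \<Rightarrow> int) \<Rightarrow> 'v set \<Rightarrow> bool" where
  "dep_space s r A \<longleftrightarrow> A \<in> subspaces s \<and> r A \<noteq> int (vector_space.dim s A)"

definition circuit ::
    "('f::field \<Rightarrow> 'v::ab_group_add \<Rightarrow> 'v) \<Rightarrow> ('v set \<Rightarrow> int) \<Rightarrow> 'v set \<Rightarrow> bool" where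
  "circuit s r C \<longleftrightarrow> dep_space s r C \<and> (\<forall>D. dep_space s r D \<and> D \<subseteq> C \<longrightarrow> D = C)"

text \<open>The sum of a family of subspaces is the span of its union; the empty sum is the zero space.\<close>

definition cyclic_space ::
    "('f::field \<Rightarrow> 'v::ab_group_add \<Rightarrow> 'v) \<Rightarrow> ('v set \<Rightarrow> int) \<Rightarrow> 'v set \<Rightarrow> bool" where
  "cyclic_space s r A \<longleftrightarrow> (\<exists>\<C>. (\<forall>C\<in>\<C>. circuit s r C) \<and> A = module.span s (\<Union>\<C>))"

definition flat ::
    "('f::field \<Rightarrow> 'v::ab_group_add \<Rightarrow> 'v) \<Rightarrow> ('v set \<Rightarrow> int) \<Rightarrow> 'v set \<Rightarrow> bool" where
  "flat s r A \<longleftrightarrow> A \<in> subspaces s \<and> (\<forall>B\<in>subspaces s. r B = r A \<and> A \<subseteq> B \<longrightarrow> B = A)"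

definition cyclic_flat ::
    "('f::field \<Rightarrow> 'v::ab_group_add \<Rightarrow> 'v) \<Rightarrow> ('v set \<Rightarrow> int) \<Rightarrow> 'v set \<Rightarrow> bool" where
  "cyclic_flat s r Z \<longleftrightarrow> cyclic_space s r Z \<and> flat s r Z"

definition free_separator ::
    "('f::field \<Rightarrow> 'v::ab_group_add \<Rightarrow> 'v) \<Rightarrow> ('v set \<Rightarrow> int) \<Rightarrow> 'v set \<Rightarrow> bool" where
  "free_separator s r A \<longleftrightarrow>
     A \<in> subspaces s \<and> (\<forall>Z. cyclic_flat s r Z \<longrightarrow> Z \<subseteq> A \<or> A \<subseteq> Z)"

definition rank_lack :: "('v set \<Rightarrow> int) \<Rightarrow> 'v set \<Rightarrow> int" where
  "rank_lack r A = r UNIV - r A"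

definition nullity ::
    "('f::field \<Rightarrow> 'v::ab_group_add \<Rightarrow> 'v) \<Rightarrow> ('v set \<Rightarrow> int) \<Rightarrow> 'v set \<Rightarrow> int" where
  "nullity s r A = int (vector_space.dim s A) - r A"

section \<open>Restriction and contraction\<close>

definition restriction ::
    "('f::field \<Rightarrow> 'v::ab_group_add \<Rightarrow> 'v) \<Rightarrow> ('v set \<Rightarrow> int) \<Rightarrow> 'v set \<Rightarrow> 'v set \<Rightarrow> int" where
  "restriction s r A = (\<lambda>X \<in> {X \<in> subspaces s. X \<subseteq> A}. r X)"

definition coset_of :: "'v::ab_group_add set \<Rightarrow> 'v \<Rightarrow> 'v set" where
  "coset_of A x = {x + a | a. a \<in> A}"

text \<open>The elements of \<open>E/A\<close> are the cosets of \<open>A\<close>; its subspaces are the sets \<open>X/A = coset_of A ` X\<close>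
  with \<open>A \<le> X \<le> E\<close>, and \<open>X\<close> is recovered from \<open>X/A\<close> as the union of its cosets
  (lemma \<open>Union_cosets\<close> below).\<close>

definition contraction ::
    "('f::field \<Rightarrow> 'v::ab_group_add \<Rightarrow> 'v) \<Rightarrow> ('v set \<Rightarrow> int) \<Rightarrow> 'v set \<Rightarrow> 'v set set \<Rightarrow> int" where
  "contraction s r A =
     (\<lambda>Q \<in> {coset_of A ` X | X. X \<in> subspaces s \<and> A \<subseteq> X}. r (\<Union>Q) - r A)"

lemma Union_cosets:
  assumes "module s" "module.subspace s A" "module.subspace s X" "A \<subseteq> X"
  shows "\<Union>(coset_of A ` X) = X"
proof -
  interpret module s by fact
  show ?thesis
  proof
    show "\<Union>(coset_of A ` X) \<subseteq> X"
      using assms(3,4) by (auto simp: coset_of_def intro: subspace_add)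
    show "X \<subseteq> \<Union>(coset_of A ` X)"
      using subspace_0[OF assms(2)] by (force simp: coset_of_def)
  qed
qed

text \<open>Given an isomorphism \<open>\<phi>\<close> from the space with scalar multiplication \<open>s\<close> onto a space \<open>F\<close>,
  \<open>transport s \<phi> r\<close> is the \<open>q\<close>-matroid \<open>(F, r)\<close> regarded as a \<open>q\<close>-matroid on the former space.
  The two isomorphisms \<open>\<phi>\<close> used are \<open>x \<mapsto> (x, 0)\<close>, from \<open>E\<^sub>1\<close> onto \<open>E\<^sub>1 \<oplus> 0\<close>, and
  \<open>y \<mapsto> (0, y) + (E\<^sub>1 \<oplus> 0)\<close>, from \<open>E\<^sub>2\<close> onto \<open>(E\<^sub>1 \<oplus> E\<^sub>2)/(E\<^sub>1 \<oplus> 0)\<close>.\<close>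

definition transport ::
    "('f::field \<Rightarrow> 'v::ab_group_add \<Rightarrow> 'v) \<Rightarrow> ('v \<Rightarrow> 'w) \<Rightarrow> ('w set \<Rightarrow> int) \<Rightarrow> 'v set \<Rightarrow> int" where
  "transport s \<phi> r = (\<lambda>B \<in> subspaces s. r (\<phi> ` B))"

lemma minors_of_direct_sum:
  fixes s1 :: "'a::field \<Rightarrow> 'b::ab_group_add \<Rightarrow> 'b" and s2 :: "'a \<Rightarrow> 'c::ab_group_add \<Rightarrow> 'c"
  assumes "vector_space s1" "vector_space s2"
  defines "s \<equiv> module_prod.scale s1 s2"
  shows "A \<in> subspaces s1 \<Longrightarrow>
      transport s1 (\<lambda>x. (x, 0)) (restriction s r (UNIV \<times> {0})) A = r (A \<times> {0})"
    and "B \<in> subspaces s2 \<Longrightarrow>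
      transport s2 (\<lambda>y. coset_of (UNIV \<times> {0}) (0, y)) (contraction s r (UNIV \<times> {0})) B =
        r (UNIV \<times> B) - r (UNIV \<times> {0})"
proof -
  interpret vector_space_prod s1 s2
    using assms(1,2) by (simp add: vector_space_prod_def vector_space_pair_def)
  note [simp] = s_def subspaces_def
  show "transport s1 (\<lambda>x. (x, 0)) (restriction s r (UNIV \<times> {0})) A = r (A \<times> {0})"
    if A: "A \<in> subspaces s1"
  proof -
    have "(\<lambda>x. (x, 0 :: 'c)) ` A = A \<times> {0}" by auto
    moreover have "p.subspace (A \<times> {0})"
      using A by (simp add: subspace_Times vs2.subspace_single_0)
    ultimately show ?thesis using A by (auto simp: transport_def restriction_def)
  qed
  show "transport s2 (\<lambda>y. coset_of (UNIV \<times> {0}) (0, y)) (contraction s r (UNIV \<times> {0})) B =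
        r (UNIV \<times> B) - r (UNIV \<times> {0})"
    if B: "B \<in> subspaces s2"
  proof -
    let ?U = "(UNIV :: 'b set) \<times> {0 :: 'c}"
    have coset: "coset_of ?U (x, y) = UNIV \<times> {y}" for x y
      by (auto simp: coset_of_def) (metis add.commute diff_add_cancel)
    have img: "(\<lambda>y. coset_of ?U (0, y)) ` B = coset_of ?U ` (UNIV \<times> B)"
      by (auto simp: image_iff coset)
    have sUB: "p.subspace (UNIV \<times> B)"
      using B by (intro subspace_Times) auto
    have "?U \<subseteq> UNIV \<times> B" using B vs2.subspace_0 by auto
    moreover have "\<Union>(coset_of ?U ` (UNIV \<times> B)) = UNIV \<times> B"
      by (auto simp: coset)
    ultimately show ?thesis using B sUB by (auto simp: transport_def contraction_def img)
  qed
qed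

section \<open>The free product\<close>

text \<open>The direct sum \<open>E\<^sub>1 \<oplus> E\<^sub>2\<close> is the product type with \<^const>\<open>module_prod.scale\<close>, the projections
  are \<^const>\<open>fst\<close> and \<^const>\<open>snd\<close>, and \<open>\<iota>\<^sub>1(E\<^sub>1) = E\<^sub>1 \<oplus> 0\<close> is \<^term>\<open>UNIV \<times> {0}\<close>.\<close>

definition free_product_indep ::
    "('f::field \<Rightarrow> 'v::ab_group_add \<Rightarrow> 'v) \<Rightarrow> ('f \<Rightarrow> 'w::ab_group_add \<Rightarrow> 'w) \<Rightarrow>
     ('v set \<Rightarrow> int) \<Rightarrow> ('w set \<Rightarrow> int) \<Rightarrow> ('v \<times> 'w) set \<Rightarrow> bool" where
  "free_product_indep s1 s2 r1 r2 I \<longleftrightarrow>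
     I \<in> subspaces (module_prod.scale s1 s2) \<and>
     indep_space s1 r1 (fst ` (I \<inter> UNIV \<times> {0})) \<and>
     rank_lack r1 (fst ` (I \<inter> UNIV \<times> {0})) \<ge> nullity s2 r2 (snd ` I)"

definition free_product ::
    "('f::field \<Rightarrow> 'v::ab_group_add \<Rightarrow> 'v) \<Rightarrow> ('f \<Rightarrow> 'w::ab_group_add \<Rightarrow> 'w) \<Rightarrow>
     ('v set \<Rightarrow> int) \<Rightarrow> ('w set \<Rightarrow> int) \<Rightarrow> ('v \<times> 'w) set \<Rightarrow> int" where
  "free_product s1 s2 r1 r2 =
     (THE r. q_matroid (module_prod.scale s1 s2) r \<and>
        (\<forall>I. indep_space (module_prod.scale s1 s2) r I \<longleftrightarrow> free_product_indep s1 s2 r1 r2 I))"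

subsection \<open>The free product is well defined\<close>

lemma q_matroid_rank_indep:
  assumes fd: "finite_dimensional_vector_space s B0" and r: "q_matroid s r" and A: "A \<in> subspaces s"
  obtains I where "indep_space s r I" "I \<subseteq> A" "r I = r A"
proof -
  interpret finite_dimensional_vector_space s B0 by fact
  have r_le: "r X \<le> int (dim X)" and r_ge: "0 \<le> r X" if "subspace X" for X
    using r that by (auto simp: q_matroid_def subspaces_def)
  have r_mono: "r X \<le> r Y" if "subspace X" "subspace Y" "X \<subseteq> Y" for X Y
    using r that by (auto simp: q_matroid_def subspaces_def)
  have r_sub: "r {a + b | a b. a \<in> X \<and> b \<in> Y} + r (X \<inter> Y) \<le> r X + r Y"
    if "subspace X" "subspace Y" for X Y
    using r that by (auto simp: q_matroid_def subspaces_def)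
  have sA: "subspace A" using A by (simp add: subspaces_def)
  have dim_bound: "\<forall>X. P X \<longrightarrow> dim X < Suc dimension" for P
    using dim_subset_UNIV by (auto simp: less_Suc_eq_le)
  define P where "P I \<longleftrightarrow> indep_space s r I \<and> I \<subseteq> A" for I
  have "r {0} = 0"
    using r_le[of "{0}"] r_ge[of "{0}"] by (simp add: subspace_single_0)
  then have "P {0}"
    using subspace_0[OF sA] by (simp add: P_def indep_space_def subspaces_def subspace_single_0)
  from ex_has_greatest_nat[where P = P and f = dim, OF this dim_bound]
  obtain I where I: "P I" and I_max: "\<And>J. P J \<Longrightarrow> dim J \<le> dim I" by blast
  have sI: "subspace I" and rI: "r I = int (dim I)" and IA: "I \<subseteq> A"
    using I by (auto simp: P_def indep_space_def subspaces_def)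
  define Q where "Q J \<longleftrightarrow> subspace J \<and> I \<subseteq> J \<and> J \<subseteq> A \<and> r J = r I" for J
  have "Q I" using sI IA by (simp add: Q_def)
  from ex_has_greatest_nat[where P = Q and f = dim, OF this dim_bound]
  obtain J where J: "Q J" and J_max: "\<And>K. Q K \<Longrightarrow> dim K \<le> dim J" by blast
  have sJ: "subspace J" and IJ: "I \<subseteq> J" and JA: "J \<subseteq> A" and rJ: "r J = r I"
    using J by (auto simp: Q_def)
  have "J = A"
  proof (rule ccontr)
    assume "J \<noteq> A"
    then obtain x where x: "x \<in> A" "x \<notin> J" using JA by blast
    let ?Ix = "span (insert x I)" and ?Jx = "span (insert x J)"
    have IxA: "?Ix \<subseteq> A" and JxA: "?Jx \<subseteq> A"
      using x IA JA sA by (intro span_minimal; blast)+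
    have dimIx: "dim ?Ix = Suc (dim I)" and dimJx: "dim ?Jx = Suc (dim J)"
      using x IJ sI sJ by (auto simp: dim_insert span_eq_iff[THEN iffD2])
    have sub: "I \<subseteq> ?Ix" "J \<subseteq> ?Jx" "x \<in> ?Ix" by (auto intro: span_base)
    have "r ?Ix = r I"
    proof (rule ccontr)
      assume "r ?Ix \<noteq> r I"
      then have "r ?Ix = int (dim ?Ix)"
        using r_mono[OF sI subspace_span sub(1)] r_le[of ?Ix] rI dimIx by auto
      then have "P ?Ix" using IxA by (simp add: P_def indep_space_def subspaces_def)
      from I_max[OF this] dimIx show False by simp
    qed
    moreover have "{a + b | a b. a \<in> J \<and> b \<in> ?Ix} = ?Jx"
    proof
      show "{a + b | a b. a \<in> J \<and> b \<in> ?Ix} \<subseteq> ?Jx"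
        using span_mono[of "insert x I" "insert x J"] IJ sub(2) by (auto intro!: span_add)
      have "J \<subseteq> {a + b | a b. a \<in> J \<and> b \<in> ?Ix}"
        using span_zero[of "insert x I"] by force
      moreover have "x \<in> {a + b | a b. a \<in> J \<and> b \<in> ?Ix}"
        using subspace_0[OF sJ] sub(3) by force
      ultimately show "?Jx \<subseteq> {a + b | a b. a \<in> J \<and> b \<in> ?Ix}"
        by (intro span_minimal subspace_sums sJ) auto
    qed
    moreover have "r I \<le> r (J \<inter> ?Ix)"
      using sub(1) IJ by (intro r_mono sI subspace_inter sJ subspace_span) auto
    ultimately have "r ?Jx \<le> r J"
      using r_sub[OF sJ, of ?Ix] by simp
    moreover have "r J \<le> r ?Jx" using sub(2) by (intro r_mono sJ) auto
    ultimately have "Q ?Jx" using sub(2) IJ JxA rJ by (auto simp: Q_def)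
    from J_max[OF this] dimJx show False by simp
  qed
  with rJ that I show ?thesis by (auto simp: P_def)
qed

lemma q_matroid_eqI:
  assumes fd: "finite_dimensional_vector_space s B0" and r: "q_matroid s r" and r': "q_matroid s r'"
    and eq: "\<And>I. indep_space s r I \<longleftrightarrow> indep_space s r' I"
  shows "r = r'"
proof -
  have le: "r1 A \<le> r2 A"
    if r1: "q_matroid s r1" and r2: "q_matroid s r2" and A: "A \<in> subspaces s"
      and eq: "\<And>I. indep_space s r1 I \<longleftrightarrow> indep_space s r2 I" for r1 r2 A
  proof -
    obtain I where I: "indep_space s r1 I" "I \<subseteq> A" "r1 I = r1 A"
      using q_matroid_rank_indep[OF fd r1 A] .
    have "r1 I = r2 I" using I(1) eq[of I] by (auto simp: indep_space_def)
    moreover have "r2 I \<le> r2 A" using I A r2 by (auto simp: q_matroid_def indep_space_def)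
    ultimately show ?thesis using I by simp
  qed
  show ?thesis
  proof (rule extensionalityI[of _ "subspaces s"])
    show "r \<in> extensional (subspaces s)" "r' \<in> extensional (subspaces s)"
      using r r' by (auto simp: q_matroid_def)
    show "r A = r' A" if "A \<in> subspaces s" for A
      using le[OF r r' that eq] le[OF r' r that] eq by (simp add: antisym)
  qed
qed

lemma q_matroid_nullity_mono:
  assumes fd: "finite_dimensional_vector_space s B0" and r: "q_matroid s r"
    and U: "module.subspace s U" and V: "module.subspace s V" and UV: "U \<subseteq> V"
  shows "int (vector_space.dim s U) - r U \<le> int (vector_space.dim s V) - r V"
proof -
  interpret finite_dimensional_vector_space s B0 by fact
  obtain C where C: "C \<subseteq> U" "independent C" "U \<subseteq> span C"
    using basis_exists by metis
  obtain D where D: "C \<subseteq> D" "D \<subseteq> V" "independent D" "V \<subseteq> span D"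
    using maximal_independent_subset_extend[of C V] C UV by (metis subset_trans)
  have UC: "span C = U" and VD: "span D = V"
    using C D U V by (intro antisym span_minimal; blast)+
  define W where "W = span (D - C)"
  have W: "subspace W" by (simp add: W_def)
  have sum: "{a + b | a b. a \<in> U \<and> b \<in> W} = V"
    using span_Un[of C "D - C"] D(1) UC VD by (simp add: W_def Un_absorb1)
  have "independent (D - C)" using D(3) independent_mono by blast
  then have "dim W = card (D - C)" by (simp add: W_def dim_eq_card_independent)
  moreover have "dim U = card C" "dim V = card D"
    using C(2) D(3) UC VD by (metis dim_span_eq_card_independent)+
  moreover have "card (D - C) + card C = card D"
    using D(1) finiteI_independent[OF D(3)] by (metis card_Diff_subset card_mono finite_subset le_add_diff_inverse2)
  ultimately have "dim V = dim U + dim W" by simp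
  moreover have "r V + r (U \<inter> W) \<le> r U + r W"
    using r U W sum by (auto simp: q_matroid_def subspaces_def)
  moreover have "0 \<le> r (U \<inter> W)" "r W \<le> int (dim W)"
    using r U W subspace_inter[OF U W] by (auto simp: q_matroid_def subspaces_def)
  ultimately show ?thesis by simp
qed

lemma free_product_ex1:
  fixes s1 :: "'a::field \<Rightarrow> 'b::ab_group_add \<Rightarrow> 'b" and s2 :: "'a \<Rightarrow> 'c::ab_group_add \<Rightarrow> 'c"
  assumes fd: "finite_dimensional_vector_space_prod s1 s2 B1 B2"
    and r1: "q_matroid s1 r1" and r2: "q_matroid s2 r2"
  shows "\<exists>!r. q_matroid (module_prod.scale s1 s2) r \<and>
    (\<forall>I. indep_space (module_prod.scale s1 s2) r I \<longleftrightarrow> free_product_indep s1 s2 r1 r2 I)"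
proof -
  interpret finite_dimensional_vector_space_prod s1 s2 B1 B2 by fact
  have r1_le: "r1 X \<le> int (vs1.dim X)" "0 \<le> r1 X" if "vs1.subspace X" for X
    using r1 that by (auto simp: q_matroid_def subspaces_def)
  have r1_mono: "r1 X \<le> r1 Y" if "vs1.subspace X" "vs1.subspace Y" "X \<subseteq> Y" for X Y
    using r1 that by (auto simp: q_matroid_def subspaces_def)
  have r1_sub: "r1 {a + b | a b. a \<in> X \<and> b \<in> Y} + r1 (X \<inter> Y) \<le> r1 X + r1 Y"
    if "vs1.subspace X" "vs1.subspace Y" for X Y
    using r1 that by (auto simp: q_matroid_def subspaces_def)
  have r2_le: "r2 X \<le> int (vs2.dim X)" "0 \<le> r2 X" if "vs2.subspace X" for X
    using r2 that by (auto simp: q_matroid_def subspaces_def)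
  have r2_mono: "r2 X \<le> r2 Y" if "vs2.subspace X" "vs2.subspace Y" "X \<subseteq> Y" for X Y
    using r2 that by (auto simp: q_matroid_def subspaces_def)
  have r2_sub: "r2 {a + b | a b. a \<in> X \<and> b \<in> Y} + r2 (X \<inter> Y) \<le> r2 X + r2 Y"
    if "vs2.subspace X" "vs2.subspace Y" for X Y
    using r2 that by (auto simp: q_matroid_def subspaces_def)
  define \<alpha> where "\<alpha> A = fst ` (A \<inter> UNIV \<times> {0})" for A :: "('b \<times> 'c) set"
  have \<alpha>_iff: "x \<in> \<alpha> A \<longleftrightarrow> (x, 0) \<in> A" for x A
    by (force simp: \<alpha>_def)
  define \<beta> where "\<beta> A = snd ` A" for A :: "('b \<times> 'c) set"
  have s\<alpha>: "vs1.subspace (\<alpha> A)" if "p.subspace A" for A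
  proof (rule vs1.subspaceI)
    show "0 \<in> \<alpha> A" using p.subspace_0[OF that] by (simp add: \<alpha>_iff zero_prod_def)
    show "x + y \<in> \<alpha> A" if "x \<in> \<alpha> A" "y \<in> \<alpha> A" for x y
      using p.subspace_add[OF \<open>p.subspace A\<close>, of "(x, 0)" "(y, 0)"] that by (simp add: \<alpha>_iff)
    show "s1 c x \<in> \<alpha> A" if "x \<in> \<alpha> A" for c x
      using p.subspace_scale[OF \<open>p.subspace A\<close>, of "(x, 0)" c] that by (simp add: \<alpha>_iff scale_def)
  qed
  have s\<beta>: "vs2.subspace (\<beta> A)" if "p.subspace A" for A
    unfolding \<beta>_def using module_hom.subspace_image[OF linear_snd[unfolded linear_iff_module_hom] that] .
  have sU: "p.subspace (UNIV \<times> {0})"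
    by (intro subspace_Times) (auto simp: vs2.subspace_single_0)
  have dim_eq: "p.dim A = vs1.dim (\<alpha> A) + vs2.dim (\<beta> A)" if A: "p.subspace A" for A
  proof -
    have "{x + y | x y. x \<in> A \<and> y \<in> (UNIV :: 'b set) \<times> {0}} = UNIV \<times> \<beta> A"
    proof (intro equalityI subsetI)
      fix z :: "'b \<times> 'c" assume "z \<in> UNIV \<times> \<beta> A"
      then obtain a where "(a, snd z) \<in> A" by (force simp: \<beta>_def)
      moreover have "z = (a, snd z) + (fst z - a, 0)" by (simp add: prod_eq_iff)
      ultimately show "z \<in> {x + y | x y. x \<in> A \<and> y \<in> UNIV \<times> {0}}" by blast
    qed (force simp: \<beta>_def)
    moreover have "A \<inter> UNIV \<times> {0} = \<alpha> A \<times> {0}" by (auto simp: \<alpha>_iff)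
    ultimately show ?thesis
      using p.dim_sums_Int[OF A sU] s\<alpha>[OF A] s\<beta>[OF A]
      by (simp add: dim_Times vs2.subspace_single_0)
  qed
  define F where "F A = r1 UNIV + r2 (\<beta> A)" for A
  define G where "G A = r1 (\<alpha> A) + int (vs2.dim (\<beta> A))" for A
  define \<rho> where "\<rho> = (\<lambda>A\<in>subspaces scale. min (F A) (G A))"
  have \<rho>: "\<rho> A = min (F A) (G A)" if "p.subspace A" for A
    using that by (simp add: \<rho>_def subspaces_def)
  have r1U: "0 \<le> r1 UNIV" "\<And>X. vs1.subspace X \<Longrightarrow> r1 X \<le> r1 UNIV"
    by (auto intro!: r1_le r1_mono)
  have "q_matroid scale \<rho>"
    unfolding q_matroid_def
  proof (intro conjI ballI impI)
    show "\<rho> \<in> extensional (subspaces scale)" by (simp add: \<rho>_def)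
  next
    fix A assume "A \<in> subspaces scale"
    then have A: "p.subspace A" by (simp add: subspaces_def)
    show "0 \<le> \<rho> A" "\<rho> A \<le> int (p.dim A)"
      using r1U(1) r1_le[OF s\<alpha>[OF A]] r2_le[OF s\<beta>[OF A]] dim_eq[OF A]
      by (auto simp: \<rho>[OF A] F_def G_def)
  next
    fix A B assume "A \<in> subspaces scale" "B \<in> subspaces scale" and AB: "A \<subseteq> B"
    then have A: "p.subspace A" and B: "p.subspace B" by (simp_all add: subspaces_def)
    have sub: "\<alpha> A \<subseteq> \<alpha> B" "\<beta> A \<subseteq> \<beta> B" using AB by (auto simp: \<alpha>_def \<beta>_def)
    show "\<rho> A \<le> \<rho> B"
      using r1_mono[OF s\<alpha>[OF A] s\<alpha>[OF B] sub(1)] r2_mono[OF s\<beta>[OF A] s\<beta>[OF B] sub(2)]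
        vs2.dim_subset[OF sub(2)]
      by (auto simp: \<rho>[OF A] \<rho>[OF B] F_def G_def)
  next
    fix A B assume "A \<in> subspaces scale" "B \<in> subspaces scale"
    then have A: "p.subspace A" and B: "p.subspace B" by (simp_all add: subspaces_def)
    define S where "S = {a + b | a b. a \<in> A \<and> b \<in> B}"
    have S: "p.subspace S" unfolding S_def by (rule p.subspace_sums[OF A B])
    have AB: "p.subspace (A \<inter> B)" by (rule p.subspace_inter[OF A B])
    define X where "X = {a + b | a b. a \<in> \<beta> A \<and> b \<in> \<beta> B}"
    have X: "vs2.subspace X" unfolding X_def by (rule vs2.subspace_sums[OF s\<beta>[OF A] s\<beta>[OF B]])
    have \<beta>S: "\<beta> S = X" by (force simp: \<beta>_def S_def X_def)
    have \<beta>I: "\<beta> (A \<inter> B) \<subseteq> \<beta> A \<inter> \<beta> B" by (auto simp: \<beta>_def)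
    have \<alpha>I: "\<alpha> (A \<inter> B) = \<alpha> A \<inter> \<alpha> B" by (auto simp: \<alpha>_iff)
    define Y where "Y = {a + b | a b. a \<in> \<alpha> A \<and> b \<in> \<alpha> B}"
    have Y: "vs1.subspace Y" unfolding Y_def by (rule vs1.subspace_sums[OF s\<alpha>[OF A] s\<alpha>[OF B]])
    have Y\<alpha>: "Y \<subseteq> \<alpha> S"
      unfolding Y_def S_def \<alpha>_iff subset_iff by force
    note sI = vs2.subspace_inter[OF s\<beta>[OF A] s\<beta>[OF B]]
    have d2: "int (vs2.dim X) + int (vs2.dim (\<beta> A \<inter> \<beta> B)) = int (vs2.dim (\<beta> A)) + int (vs2.dim (\<beta> B))"
      using vs2.dim_sums_Int[OF s\<beta>[OF A] s\<beta>[OF B]] unfolding X_def by linarith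
    have d1: "int (vs1.dim Y) + int (vs1.dim (\<alpha> A \<inter> \<alpha> B)) = int (vs1.dim (\<alpha> A)) + int (vs1.dim (\<alpha> B))"
      using vs1.dim_sums_Int[OF s\<alpha>[OF A] s\<alpha>[OF B]] unfolding Y_def by linarith
    have dS: "int (p.dim S) + int (p.dim (A \<inter> B)) = int (p.dim A) + int (p.dim B)"
      using p.dim_sums_Int[OF A B] unfolding S_def by linarith
    have dI: "int (vs2.dim (\<beta> (A \<inter> B))) \<le> int (vs2.dim (\<beta> A \<inter> \<beta> B))"
      using vs2.dim_subset[OF \<beta>I] by simp
    have r2I: "r2 (\<beta> (A \<inter> B)) \<le> r2 (\<beta> A \<inter> \<beta> B)"
      by (rule r2_mono[OF s\<beta>[OF AB] sI \<beta>I])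
    have r2S: "r2 X + r2 (\<beta> A \<inter> \<beta> B) \<le> r2 (\<beta> A) + r2 (\<beta> B)"
      unfolding X_def by (rule r2_sub[OF s\<beta>[OF A] s\<beta>[OF B]])
    have FF: "F S + F (A \<inter> B) \<le> F A + F B"
      using r2S r2I by (simp add: F_def \<beta>S)
    have GG: "G S + G (A \<inter> B) \<le> G A + G B"
    proof -
      have "r1 Y + r1 (\<alpha> A \<inter> \<alpha> B) \<le> r1 (\<alpha> A) + r1 (\<alpha> B)"
        unfolding Y_def by (rule r1_sub[OF s\<alpha>[OF A] s\<alpha>[OF B]])
      moreover have "r1 (\<alpha> S) - int (vs1.dim (\<alpha> S)) \<le> r1 Y - int (vs1.dim Y)"
        using q_matroid_nullity_mono[OF vs1.finite_dimensional_vector_space_axioms r1 Y s\<alpha>[OF S] Y\<alpha>] by simp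
      ultimately show ?thesis
        using dS d1 dim_eq[OF A] dim_eq[OF B] dim_eq[OF S] dim_eq[OF AB] \<alpha>I by (simp add: G_def)
    qed
    have FG: "F S + G (A \<inter> B) \<le> F C + G D"
      if "C = A \<and> D = B \<or> C = B \<and> D = A" for C D
    proof -
      have C: "p.subspace C" and D: "p.subspace D" using that A B by auto
      have "\<beta> C \<subseteq> X"
        using that vs2.subspace_0[OF s\<beta>[OF A]] vs2.subspace_0[OF s\<beta>[OF B]]
        unfolding X_def by force
      note \<beta>C = this
      have "r1 (\<alpha> (A \<inter> B)) \<le> r1 (\<alpha> D)"
        using that by (intro r1_mono s\<alpha> AB D) (auto simp: \<alpha>I)
      moreover have "r2 X - int (vs2.dim X) \<le> r2 (\<beta> C) - int (vs2.dim (\<beta> C))"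
        using q_matroid_nullity_mono[OF vs2.finite_dimensional_vector_space_axioms r2 s\<beta>[OF C] X]
          \<beta>C by simp
      ultimately show ?thesis
        using d2 dI that by (auto simp: F_def G_def \<beta>S)
    qed
    show "\<rho> {a + b | a b. a \<in> A \<and> b \<in> B} + \<rho> (A \<inter> B) \<le> \<rho> A + \<rho> B"
      using FF GG FG[of A B] FG[of B A] unfolding S_def[symmetric] \<rho>[OF A] \<rho>[OF B] \<rho>[OF S] \<rho>[OF AB]
      by (simp add: min_def)
  qed
  moreover have "indep_space scale \<rho> I \<longleftrightarrow> free_product_indep s1 s2 r1 r2 I" for I
  proof (cases "p.subspace I")
    case True
    then show ?thesis
      using r1_le[OF s\<alpha>[OF True]] s\<alpha>[OF True] dim_eq[OF True]
      by (auto simp: indep_space_def free_product_indep_def subspaces_def rank_lack_def nullity_def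
          \<alpha>_def[symmetric] \<beta>_def[symmetric] \<rho> F_def G_def)
  qed (simp add: indep_space_def free_product_indep_def subspaces_def)
  ultimately show ?thesis
    using q_matroid_eqI[OF p.finite_dimensional_vector_space_axioms] by (intro ex1I[of _ \<rho>]) auto
qed

end

theory Submission
  imports Defs
begin

text \<open>Write \<open>U = E\<^sub>1 \<oplus> 0\<close>.  Expressed through \<open>r\<close>, the space \<open>I\<close> is independent in the free product of
  \<open>M|U\<close> and \<open>M/U\<close> iff \<open>I \<inter> U\<close> is independent in \<open>M\<close> and \<open>r (I + U) \<ge> dim I\<close>.  This always holds for
  independent \<open>I\<close>, so (i) says that every dependent \<open>I\<close> with \<open>I \<inter> U\<close> independent satisfies
  \<open>r (I + U) < dim I\<close>.

  If \<open>U\<close> is a free separator and \<open>I\<close> is such a space, let \<open>F\<close> be the closure of \<open>I\<close>; the sum \<open>Z\<close> of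
  all circuits in \<open>F\<close> is a cyclic flat.  It is not contained in \<open>U\<close>, since \<open>I\<close> contains a circuit
  and \<open>I \<inter> U\<close> does not; so \<open>U \<le> Z \<le> F\<close> and \<open>r (I + U) \<le> r F = r I < dim I\<close>.  Conversely, if a cyclic
  flat \<open>Z\<close> is not contained in \<open>U\<close>, then neither is some circuit \<open>C \<le> Z\<close>.  As \<open>C \<inter> U\<close> is independent,
  \<open>r (C + U) \<le> dim C - 1 = r C\<close>, so \<open>U\<close> lies in the closure of \<open>C\<close>, hence in \<open>Z\<close>.\<close>

section \<open>A single q-matroid: circuits, closures, cyclic flats and free separators\<close>

locale q_matroid_on = finite_dimensional_vector_space s Basis
  for s :: "'f::field \<Rightarrow> 'v::ab_group_add \<Rightarrow> 'v" and Basis :: "'v set" +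
  fixes r :: "'v set \<Rightarrow> int"
  assumes q_matroid: "q_matroid s r"
begin

lemma rank_le_dim: "subspace A \<Longrightarrow> r A \<le> int (dim A)"
  and rank_nonneg: "subspace A \<Longrightarrow> 0 \<le> r A"
  and rank_mono: "subspace A \<Longrightarrow> subspace B \<Longrightarrow> A \<subseteq> B \<Longrightarrow> r A \<le> r B"
  and rank_submodular: "subspace A \<Longrightarrow> subspace B \<Longrightarrow>
    r {a + b | a b. a \<in> A \<and> b \<in> B} + r (A \<inter> B) \<le> r A + r B"
  using q_matroid by (auto simp: q_matroid_def subspaces_def)

lemma nullity_mono:
  "subspace A \<Longrightarrow> subspace B \<Longrightarrow> A \<subseteq> B \<Longrightarrow> int (dim A) - r A \<le> int (dim B) - r B"
  by (rule q_matroid_nullity_mono[OF finite_dimensional_vector_space_axioms q_matroid])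

text \<open>Independence means nullity zero, and nullity is nonnegative and monotone.\<close>

lemma indep_space_subset:
  assumes "indep_space s r A" "subspace B" "B \<subseteq> A"
  shows "indep_space s r B"
  using assms nullity_mono[of B A] rank_le_dim[of B] by (simp add: indep_space_def subspaces_def)

lemma indep_space_iff_not_dep: "subspace A \<Longrightarrow> indep_space s r A \<longleftrightarrow> \<not> dep_space s r A"
  by (simp add: indep_space_def dep_space_def subspaces_def)

lemma sums_superset:
  assumes "subspace A" "subspace B"
  shows "A \<subseteq> {a + b | a b. a \<in> A \<and> b \<in> B}" "B \<subseteq> {a + b | a b. a \<in> A \<and> b \<in> B}"
  using subspace_0[OF assms(1)] subspace_0[OF assms(2)] by force+

text \<open>A dependent subspace of \<open>A\<close> of least dimension is a circuit.\<close>

lemma dep_space_contains_circuit: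
  assumes "dep_space s r A"
  obtains C where "circuit s r C" "C \<subseteq> A"
proof -
  obtain C where C: "dep_space s r C" "C \<subseteq> A"
    and min: "\<And>D. dep_space s r D \<Longrightarrow> D \<subseteq> A \<Longrightarrow> dim C \<le> dim D"
    using ex_has_least_nat[of "\<lambda>D. dep_space s r D \<and> D \<subseteq> A" A dim] assms by blast
  have "D = C" if D: "dep_space s r D" "D \<subseteq> C" for D
    using D C min[of D] by (intro subspace_dim_equal) (auto simp: dep_space_def subspaces_def)
  with C that show thesis by (auto simp: circuit_def)
qed

lemma circuitD:
  assumes "circuit s r C"
  shows "subspace C" "\<not> indep_space s r C" "r C = int (dim C) - 1"
    and "\<And>A. subspace A \<Longrightarrow> A \<subset> C \<Longrightarrow> indep_space s r A"
proof -
  show sC: "subspace C" and "\<not> indep_space s r C"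
    using assms by (auto simp: circuit_def dep_space_def subspaces_def indep_space_def)
  have rC: "r C < int (dim C)"
    using assms rank_le_dim[OF sC] by (auto simp: circuit_def dep_space_def)
  show indep: "indep_space s r A" if "subspace A" "A \<subset> C" for A
    using assms that by (auto simp: circuit_def indep_space_iff_not_dep)
  obtain b where b: "b \<subseteq> C" "independent b" "C \<subseteq> span b" "card b = dim C"
    using basis_exists by blast
  have "card b \<noteq> 0" using b(4) rC rank_nonneg[OF sC] by linarith
  then obtain x where x: "x \<in> b" by fastforce
  \<comment> \<open>A hyperplane of \<open>C\<close>. It is independent by minimality of
    \<open>C\<close>, so \<open>r C\<close> is at least \<open>dim C - 1\<close>.\<close>
  let ?H = "span (b - {x})"
  have "?H \<subseteq> C" using b(1) sC by (intro span_minimal) auto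
  moreover have "x \<notin> ?H" using b(2) x by (auto simp: dependent_def)
  ultimately have "r ?H = int (dim ?H)" "r ?H \<le> r C"
    using indep[of ?H] rank_mono[of ?H C] sC x b(1) by (auto simp: indep_space_def)
  moreover have "dim ?H = card (b - {x})"
    using b(2) independent_mono[of b "b - {x}"] by (simp add: dim_eq_card_independent)
  moreover have "card b = Suc (card (b - {x}))"
    using x finiteI_independent[OF b(2)] by (rule card.remove[rotated])
  ultimately show "r C = int (dim C) - 1" using rC b(4) by linarith
qed

lemma flat_closure:
  assumes "subspace A"
  obtains F where "flat s r F" "A \<subseteq> F" "r F = r A"
proof -
  let ?P = "\<lambda>F. subspace F \<and> A \<subseteq> F \<and> r F = r A"
  \<comment> \<open>The closure is chosen of greatest dimension among the superspaces of the same
    rank; \<open>ex_has_greatest_nat\<close> wants a strict bound, hence \<open>Suc\<close>.\<close>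
  have "\<forall>F. ?P F \<longrightarrow> dim F < Suc dimension"
    using dim_subset_UNIV by (auto simp: less_Suc_eq_le)
  from ex_has_greatest_nat[where P = ?P and f = dim, OF _ this, of A] assms
  obtain F where F: "?P F" and max: "\<And>G. ?P G \<Longrightarrow> dim G \<le> dim F" by auto
  have "G = F" if G: "subspace G" "r G = r F" "F \<subseteq> G" for G
  proof -
    have "dim G \<le> dim F" using F G by (intro max) auto
    with F G show ?thesis using subspace_dim_equal[of F G] by simp
  qed
  with F that show thesis by (auto simp: flat_def subspaces_def)
qed

text \<open>\<open>X\<close> adds no rank to \<open>Y\<close>, so by submodularity it adds none to
  the larger space \<open>F\<close>: the intersection of \<open>F\<close> and \<open>X\<close>
  contains \<open>Y\<close> and so has rank at least \<open>r X\<close>. A flat of unchanged rank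
  cannot grow.\<close>

lemma flat_absorbs:
  assumes F: "flat s r F" and X: "subspace X" and Y: "subspace Y" "Y \<subseteq> X" "Y \<subseteq> F"
    and eq: "r X \<le> r Y"
  shows "X \<subseteq> F"
proof -
  have sF: "subspace F" using F by (simp add: flat_def subspaces_def)
  define S where "S = {a + b | a b. a \<in> F \<and> b \<in> X}"
  have S: "subspace S" unfolding S_def by (rule subspace_sums[OF sF X])
  have sup: "F \<subseteq> S" "X \<subseteq> S" unfolding S_def by (rule sums_superset[OF sF X])+
  have "r Y \<le> r (F \<inter> X)" using Y sF X by (intro rank_mono subspace_inter) auto
  then have "r S = r F"
    using rank_submodular[OF sF X] rank_mono[OF sF S sup(1)] eq unfolding S_def by linarith
  with F S sup(1) have "S = F" unfolding flat_def subspaces_def by auto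
  with sup(2) show ?thesis by simp
qed

text \<open>If some \<open>x\<close> outside \<open>?Z\<close> could be added without raising the
  rank, then together with a full-rank independent subspace \<open>I\<close> of \<open>?Z\<close> it
  would span a dependent space. A circuit in that space lies in \<open>F\<close>, hence in
  \<open>?Z\<close>, and this forces it into \<open>I\<close>.\<close>

lemma cyclic_flat_span_circuits:
  assumes F: "flat s r F"
  shows "cyclic_flat s r (span (\<Union>{C. circuit s r C \<and> C \<subseteq> F}))" (is "cyclic_flat s r ?Z")
  unfolding cyclic_flat_def
proof
  show "cyclic_space s r ?Z"
    unfolding cyclic_space_def by (intro exI[of _ "{C. circuit s r C \<and> C \<subseteq> F}"]) simp
  have sF: "subspace F" using F by (simp add: flat_def subspaces_def)
  have ZF: "?Z \<subseteq> F" using sF by (intro span_minimal) auto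
  have "B \<subseteq> ?Z" if B: "subspace B" "r B = r ?Z" "?Z \<subseteq> B" for B
  proof
    fix x assume x: "x \<in> B"
    show "x \<in> ?Z"
    proof (rule ccontr)
      assume xZ: "x \<notin> ?Z"
      obtain I where I: "indep_space s r I" "I \<subseteq> ?Z" "r I = r ?Z"
        using q_matroid_rank_indep[OF finite_dimensional_vector_space_axioms q_matroid, of ?Z]
        by (auto simp: subspaces_def)
      have sI: "subspace I" using I by (simp add: indep_space_def subspaces_def)
      let ?J = "span (insert x I)"
      have JB: "?J \<subseteq> B" using x I(2) B by (intro span_minimal) auto
      have "dim ?J = Suc (dim I)"
        using xZ I(2) sI by (auto simp: dim_insert span_eq_iff[THEN iffD2])
      with I B rank_mono[OF subspace_span B(1) JB] have "dep_space s r ?J"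
        by (auto simp: dep_space_def subspaces_def indep_space_def)
      then obtain D where D: "circuit s r D" "D \<subseteq> ?J" by (rule dep_space_contains_circuit)
      \<comment> \<open>All of \<open>B\<close> lies in \<open>F\<close>, because \<open>B\<close>
        has the rank of its subspace \<open>?Z\<close>, which is contained in the flat
        \<open>F\<close>.\<close>
      have "D \<subseteq> F"
        using flat_absorbs[OF F B(1) subspace_span B(3) ZF] B(2) D(2) JB by simp
      then have DZ: "D \<subseteq> ?Z" using D(1) by (auto intro: span_base)
      have "D \<subseteq> I"
      proof
        fix d assume d: "d \<in> D"
        \<comment> \<open>The coefficient \<open>k\<close> of \<open>x\<close> must vanish:
          \<open>d\<close> and \<open>d - s k x\<close> both lie in \<open>?Z\<close>, so a nonzero
          \<open>k\<close> would put \<open>x\<close> there.\<close>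
        then obtain k where k: "d - s k x \<in> I"
          using D(2) sI by (auto simp: span_insert span_eq_iff[THEN iffD2])
        then have "d - (d - s k x) \<in> ?Z"
          using d k by (intro span_diff subsetD[OF DZ] subsetD[OF I(2)])
        then have "s k x \<in> ?Z" by simp
        from span_scale[OF this, of "inverse k"] xZ have "k = 0" by (cases "k = 0") simp_all
        with k show "d \<in> I" by simp
      qed
      then show False using indep_space_subset[OF I(1)] circuitD[OF D(1)] by blast
    qed
  qed
  then show "flat s r ?Z" unfolding flat_def subspaces_def by auto
qed

text \<open>The right-hand side is the only nontrivial inclusion between the independent spaces of
  the free product and those of the q-matroid, written in terms of \<open>r\<close> alone.\<close>

lemma free_separator_iff:
  assumes U: "subspace U"
  shows "free_separator s r U \<longleftrightarrow>
    (\<forall>I. subspace I \<longrightarrow> indep_space s r (I \<inter> U) \<longrightarrow>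
      int (dim I) \<le> r {a + b | a b. a \<in> I \<and> b \<in> U} \<longrightarrow> indep_space s r I)" (is "_ \<longleftrightarrow> ?R")
proof
  assume sep: "free_separator s r U"
  show ?R
  proof (intro allI impI, rule ccontr)
    fix I assume I: "subspace I" "indep_space s r (I \<inter> U)"
      and dim_le: "int (dim I) \<le> r {a + b | a b. a \<in> I \<and> b \<in> U}"
      and "\<not> indep_space s r I"
    then have "dep_space s r I" by (simp add: indep_space_iff_not_dep)
    then obtain C where C: "circuit s r C" "C \<subseteq> I" by (rule dep_space_contains_circuit)
    obtain F where F: "flat s r F" "I \<subseteq> F" "r F = r I" using flat_closure[OF I(1)] .
    have sF: "subspace F" using F by (simp add: flat_def subspaces_def)
    let ?Z = "span (\<Union>{C. circuit s r C \<and> C \<subseteq> F})"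
    have ZF: "?Z \<subseteq> F" using sF by (intro span_minimal) auto
    have "\<not> C \<subseteq> U"
      using indep_space_subset[OF I(2)] circuitD[OF C(1)] C(2) by blast
    moreover have "C \<subseteq> ?Z" using C F(2) by (auto intro: span_base)
    ultimately have "U \<subseteq> ?Z"
      using sep cyclic_flat_span_circuits[OF F(1)] unfolding free_separator_def by blast
    then have "{a + b | a b. a \<in> I \<and> b \<in> U} \<subseteq> F"
      using ZF F(2) subspace_add[OF sF] by blast
    with dim_le F(3) rank_mono[OF subspace_sums[OF I(1) U] sF] rank_le_dim[OF I(1)]
    have "r I = int (dim I)" by simp
    with \<open>dep_space s r I\<close> show False by (simp add: dep_space_def)
  qed
next
  assume R: ?R
  have "U \<subseteq> Z" if Z: "cyclic_flat s r Z" and ZU: "\<not> Z \<subseteq> U" for Z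
  proof -
    obtain \<C> where \<C>: "\<And>C. C \<in> \<C> \<Longrightarrow> circuit s r C" "Z = span (\<Union>\<C>)"
      using Z by (auto simp: cyclic_flat_def cyclic_space_def)
    then obtain C where C: "C \<in> \<C>" "\<not> C \<subseteq> U" using ZU span_minimal[OF _ U, of "\<Union>\<C>"] by blast
    note circ = circuitD[OF \<C>(1)[OF C(1)]]
    define S where "S = {a + b | a b. a \<in> C \<and> b \<in> U}"
    have S: "subspace S" unfolding S_def by (rule subspace_sums[OF circ(1) U])
    have sup: "C \<subseteq> S" "U \<subseteq> S" unfolding S_def by (rule sums_superset[OF circ(1) U])+
    have "indep_space s r (C \<inter> U)" using C(2) by (intro circ(4) subspace_inter circ(1) U) auto
    \<comment> \<open>Contraposition of \<open>R\<close> for \<open>C\<close>: since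
      \<open>C\<close> is dependent, \<open>r S\<close> is less than \<open>dim C\<close>, which is
      \<open>r C + 1\<close>.\<close>
    from R[rule_format, OF circ(1) this] circ(2) have "\<not> int (dim C) \<le> r S"
      unfolding S_def by blast
    then have "r S \<le> r C" using circ(3) by linarith
    moreover have "C \<subseteq> Z" using \<C>(2) C(1) by (auto intro: span_base)
    moreover have "flat s r Z" using Z by (simp add: cyclic_flat_def)
    ultimately have "S \<subseteq> Z" using flat_absorbs[of Z S C] S circ(1) sup(1) by simp
    then show ?thesis using sup(2) by simp
  qed
  then show "free_separator s r U" using U by (auto simp: free_separator_def subspaces_def)
qed

end

section \<open>Minors of a direct sum and independence in their free product\<close>

context finite_dimensional_vector_space_prod
begin

lemma subspace_fst_kernel_snd: "p.subspace A \<Longrightarrow> vs1.subspace (fst ` (A \<inter> UNIV \<times> {0}))"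
  by (intro module_hom.subspace_image[OF linear_fst[unfolded linear_iff_module_hom]] p.subspace_inter
      subspace_Times vs1.subspace_UNIV vs2.subspace_single_0)

lemma subspace_snd_image: "p.subspace A \<Longrightarrow> vs2.subspace (snd ` A)"
  by (rule module_hom.subspace_image[OF linear_snd[unfolded linear_iff_module_hom]])

lemma sums_UNIV_Times:
  fixes A :: "('b \<times> 'c) set"
  shows "{a + b | a b. a \<in> A \<and> b \<in> UNIV \<times> {0}} = UNIV \<times> snd ` A"
proof (intro equalityI subsetI)
  fix z :: "'b \<times> 'c" assume "z \<in> UNIV \<times> snd ` A"
  then obtain a where "(a, snd z) \<in> A" by force
  moreover have "z = (a, snd z) + (fst z - a, 0)" by (simp add: prod_eq_iff)
  ultimately show "z \<in> {a + b | a b. a \<in> A \<and> b \<in> UNIV \<times> {0}}" by blast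
qed force

text \<open>Rank-nullity for \<open>snd\<close> restricted to \<open>A\<close>, obtained from the
  dimension formula for the sum with \<open>UNIV \<times> {0}\<close>.\<close>

lemma dim_eq_kernel_image:
  assumes A: "p.subspace A"
  shows "p.dim A = p.dim (A \<inter> UNIV \<times> {0}) + vs2.dim (snd ` A)"
proof -
  have "p.subspace (UNIV \<times> {0})"
    by (intro subspace_Times vs1.subspace_UNIV vs2.subspace_single_0)
  from p.dim_sums_Int[OF A this, unfolded sums_UNIV_Times] show ?thesis
    using subspace_snd_image[OF A] by (simp add: dim_Times vs2.subspace_single_0)
qed

text \<open>\<open>free_product\<close> is a definite description, and its well-definedness requires
  both factors to be q-matroids. The axioms pull back along the maps sending \<open>A\<close> to
  \<open>A \<times> {0}\<close> and \<open>B\<close> to \<open>UNIV \<times> B\<close>, which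
  preserve inclusions, sums and intersections.\<close>

lemma q_matroid_minors:
  assumes r: "q_matroid scale r"
  shows "q_matroid s1 (transport s1 (\<lambda>x. (x, 0)) (restriction scale r (UNIV \<times> {0})))"
    and "q_matroid s2 (transport s2 (\<lambda>y. coset_of (UNIV \<times> {0}) (0, y))
      (contraction scale r (UNIV \<times> {0})))"
proof -
  interpret M: q_matroid_on scale Basis_pair r
    by unfold_locales (rule r)
  note minors = minors_of_direct_sum[OF vs1.vector_space_axioms vs2.vector_space_axioms]
  have sub1: "p.subspace (A \<times> {0})" if "vs1.subspace A" for A
    using that by (simp add: subspace_Times vs2.subspace_single_0)
  have sub2: "p.subspace (UNIV \<times> B)" if "vs2.subspace B" for B
    using that by (simp add: subspace_Times)
  show "q_matroid s1 (transport s1 (\<lambda>x. (x, 0)) (restriction scale r (UNIV \<times> {0})))"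
    (is "q_matroid s1 ?r1")
    unfolding q_matroid_def
  proof (intro conjI ballI impI; (unfold subspaces_def mem_Collect_eq)?)
    fix A assume A: "vs1.subspace A"
    show "?r1 A \<le> int (vs1.dim A)"
      "0 \<le> ?r1 A"
      using A M.rank_le_dim[OF sub1[OF A]] M.rank_nonneg[OF sub1[OF A]]
      by (simp_all add: minors subspaces_def dim_Times vs2.subspace_single_0)
    fix B assume B: "vs1.subspace B"
    show "?r1 A \<le> ?r1 B" if "A \<subseteq> B"
      using that A B M.rank_mono[OF sub1[OF A] sub1[OF B]]
      by (auto simp: minors subspaces_def)
    have "{a + b | a b. a \<in> A \<times> {0 :: 'c} \<and> b \<in> B \<times> {0}} = {a + b | a b. a \<in> A \<and> b \<in> B} \<times> {0}"
      by force
    moreover have "A \<times> {0 :: 'c} \<inter> B \<times> {0} = (A \<inter> B) \<times> {0}" by auto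
    ultimately show "?r1 {a + b | a b. a \<in> A \<and> b \<in> B} + ?r1 (A \<inter> B) \<le> ?r1 A + ?r1 B"
      using M.rank_submodular[OF sub1[OF A] sub1[OF B]] A B
      by (simp add: minors subspaces_def vs1.subspace_sums vs1.subspace_inter)
  qed (simp add: transport_def subspaces_def)
  have U: "p.subspace (UNIV \<times> {0})" by (rule sub2[OF vs2.subspace_single_0])
  show "q_matroid s2 (transport s2 (\<lambda>y. coset_of (UNIV \<times> {0}) (0, y))
      (contraction scale r (UNIV \<times> {0})))" (is "q_matroid s2 ?r2")
    unfolding q_matroid_def
  proof (intro conjI ballI impI; (unfold subspaces_def mem_Collect_eq)?)
    fix A assume A: "vs2.subspace A"
    have "UNIV \<times> {0} \<subseteq> (UNIV :: 'b set) \<times> A" using vs2.subspace_0[OF A] by auto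
    \<comment> \<open>The upper bound says that nullity does not drop from
      \<open>UNIV \<times> {0}\<close> to \<open>UNIV \<times> A\<close>.\<close>
    then show "?r2 A \<le> int (vs2.dim A)" "0 \<le> ?r2 A"
      using A M.nullity_mono[OF U sub2[OF A]] M.rank_mono[OF U sub2[OF A]]
      by (simp_all add: minors subspaces_def dim_Times vs2.subspace_single_0)
    fix B assume B: "vs2.subspace B"
    show "?r2 A \<le> ?r2 B" if "A \<subseteq> B"
      using that A B M.rank_mono[OF sub2[OF A] sub2[OF B]]
      by (auto simp: minors subspaces_def)
    have "{a + b | a b. a \<in> (UNIV :: 'b set) \<times> A \<and> b \<in> UNIV \<times> B} =
        UNIV \<times> {a + b | a b. a \<in> A \<and> b \<in> B}"
    proof (intro equalityI subsetI)
      fix z :: "'b \<times> 'c" assume "z \<in> UNIV \<times> {a + b | a b. a \<in> A \<and> b \<in> B}"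
      then obtain a b where "a \<in> A" "b \<in> B" "z = (fst z, a) + (0, b)" by (force simp: prod_eq_iff)
      then show "z \<in> {a + b | a b. a \<in> UNIV \<times> A \<and> b \<in> UNIV \<times> B}" by blast
    qed force
    moreover have "(UNIV :: 'b set) \<times> A \<inter> UNIV \<times> B = UNIV \<times> (A \<inter> B)" by auto
    ultimately show "?r2 {a + b | a b. a \<in> A \<and> b \<in> B} + ?r2 (A \<inter> B) \<le> ?r2 A + ?r2 B"
      using M.rank_submodular[OF sub2[OF A] sub2[OF B]] A B
      by (simp add: minors subspaces_def vs2.subspace_sums vs2.subspace_inter)
  qed (simp add: transport_def subspaces_def)
qed

lemma free_product_indep_minors_iff:
  assumes r: "q_matroid scale r" and I: "p.subspace I"
  shows "free_product_indep s1 s2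
      (transport s1 (\<lambda>x. (x, 0)) (restriction scale r (UNIV \<times> {0})))
      (transport s2 (\<lambda>y. coset_of (UNIV \<times> {0}) (0, y)) (contraction scale r (UNIV \<times> {0}))) I \<longleftrightarrow>
    indep_space scale r (I \<inter> UNIV \<times> {0}) \<and>
    int (p.dim I) \<le> r {a + b | a b. a \<in> I \<and> b \<in> UNIV \<times> {0}}"
proof -
  note minors = minors_of_direct_sum[OF vs1.vector_space_axioms vs2.vector_space_axioms]
  let ?A = "fst ` (I \<inter> UNIV \<times> {0})"
  have A: "vs1.subspace ?A" by (rule subspace_fst_kernel_snd[OF I])
  have "?A \<times> {0} = I \<inter> UNIV \<times> {0}" by force
  moreover from this have "p.dim (I \<inter> UNIV \<times> {0}) = vs1.dim ?A"
    using dim_Times[OF A vs2.subspace_single_0] by simp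
  moreover have "p.subspace (I \<inter> UNIV \<times> {0})"
    using I by (intro p.subspace_inter subspace_Times vs1.subspace_UNIV vs2.subspace_single_0)
  ultimately show ?thesis
    using A I subspace_snd_image[OF I] dim_eq_kernel_image[OF I] unfolding sums_UNIV_Times
    by (auto simp: free_product_indep_def indep_space_def rank_lack_def nullity_def minors
        subspaces_def)
qed

end

theorem theorem4p19:
  fixes s1 :: "'f::{field,finite} \<Rightarrow> 'v::ab_group_add \<Rightarrow> 'v"
    and s2 :: "'f \<Rightarrow> 'w::ab_group_add \<Rightarrow> 'w"
    and B1 :: "'v set" and B2 :: "'w set"
    and r :: "('v \<times> 'w) set \<Rightarrow> int"
  assumes "finite_dimensional_vector_space_prod s1 s2 B1 B2"
    and "q_matroid (module_prod.scale s1 s2) r"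
  shows "r = free_product s1 s2
               (transport s1 (\<lambda>x. (x, 0))
                 (restriction (module_prod.scale s1 s2) r (UNIV \<times> {0})))
               (transport s2 (\<lambda>y. coset_of (UNIV \<times> {0}) (0, y))
                 (contraction (module_prod.scale s1 s2) r (UNIV \<times> {0})))
         \<longleftrightarrow> free_separator (module_prod.scale s1 s2) r (UNIV \<times> {0})"
proof -
  interpret finite_dimensional_vector_space_prod s1 s2 B1 B2 by fact
  interpret M: q_matroid_on scale Basis_pair r
    by unfold_locales fact
  let ?r1 = "transport s1 (\<lambda>x. (x, 0)) (restriction scale r (UNIV \<times> {0}))"
    and ?r2 = "transport s2 (\<lambda>y. coset_of (UNIV \<times> {0}) (0, y))
      (contraction scale r (UNIV \<times> {0}))"
    and ?U = "(UNIV :: 'v set) \<times> {0 :: 'w}"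
  note r = M.q_matroid
  have U: "p.subspace ?U" by (intro subspace_Times vs1.subspace_UNIV vs2.subspace_single_0)
  define P where "P r' \<longleftrightarrow> q_matroid scale r' \<and>
      (\<forall>I. indep_space scale r' I \<longleftrightarrow> free_product_indep s1 s2 ?r1 ?r2 I)" for r'
  have ex1: "\<exists>!r'. P r'"
    unfolding P_def by (intro free_product_ex1[OF assms(1)] q_matroid_minors r)
  have "free_product s1 s2 ?r1 ?r2 = (THE r'. P r')"
    by (simp add: free_product_def P_def)
  \<comment> \<open>By unique existence, being the described object is the same as having the
    describing property.\<close>
  then have "r = free_product s1 s2 ?r1 ?r2 \<longleftrightarrow> P r"
    using theI'[OF ex1] the1_equality[OF ex1] by metis
  also have "\<dots> \<longleftrightarrow> (\<forall>I. indep_space scale r I \<longleftrightarrow> free_product_indep s1 s2 ?r1 ?r2 I)"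
    using r by (simp add: P_def)
  also have "\<dots> \<longleftrightarrow> (\<forall>I. p.subspace I \<longrightarrow> (indep_space scale r I \<longleftrightarrow>
      indep_space scale r (I \<inter> ?U) \<and> int (p.dim I) \<le> r {a + b | a b. a \<in> I \<and> b \<in> ?U}))"
  proof (intro iff_allI)
    fix I
    show "(indep_space scale r I \<longleftrightarrow> free_product_indep s1 s2 ?r1 ?r2 I) \<longleftrightarrow>
      (p.subspace I \<longrightarrow> (indep_space scale r I \<longleftrightarrow>
        indep_space scale r (I \<inter> ?U) \<and> int (p.dim I) \<le> r {a + b | a b. a \<in> I \<and> b \<in> ?U}))"
    proof (cases "p.subspace I")
      case True
      then show ?thesis by (simp add: free_product_indep_minors_iff[OF r])
    qed (simp add: indep_space_def free_product_indep_def subspaces_def)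
  qed
  also have "\<dots> \<longleftrightarrow> free_separator scale r ?U"
  proof -
    \<comment> \<open>One direction of the equivalence holds for every \<open>r\<close>: an
      independent \<open>I\<close> has \<open>dim I = r I\<close>, and rank grows when
      \<open>?U\<close> is added. What remains is the criterion for free separators.\<close>
    have "indep_space scale r (I \<inter> ?U) \<and> int (p.dim I) \<le> r {a + b | a b. a \<in> I \<and> b \<in> ?U}"
      if I: "p.subspace I" "indep_space scale r I" for I
      using M.indep_space_subset[OF I(2) p.subspace_inter[OF I(1) U]] I(2)
        M.rank_mono[OF I(1) p.subspace_sums[OF I(1) U] M.sums_superset(1)[OF I(1) U]]
      by (simp add: indep_space_def)
    then show ?thesis unfolding M.free_separator_iff[OF U] by blast
  qed
  finally show ?thesis .
qed

end
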